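(* Every polynomial computed by an algebraic branching program (ABP) of size $s$ can be represented as a DPP of size $\mathrm{poly}(s)$: there exist $N\le\mathrm{poly}(s)$, a constant matrix $L\in\mathbb{F}^{N\times N}$ and affine linear forms $\ell_1,\dots,\ell_N$ in the variables of the ABP (each being a constant or a single variable) such that the polynomial computed by the ABP equals $\det\big(L+\mathrm{diag}(\ell_1,\dots,\ell_N)\big)$.
   Context: An algebraic branching program (ABP) is a directed acyclic graph with a source $s$ and a sink $t$ whose edges are labeled with field constants or variables; the weight of an $s$–$t$ path is the product of its edge labels, and the ABP computes the sum of the weights of all $s$–$t$ paths. Its size is its number of nodes and edges. A determinantal point process (DPP), viewed as a polynomial, is $\det(L+\mathbf{X})$ with $L$ a constant $N\times N$ matrix and $\mathbf{X}$ a diagonal matrix of variables; its size is $N$. $\mathbb{F}$ is the underlying field; positive semidefiniteness of $L$ is not required. *)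

theory Defs
  imports
    "Graph_Theory.Graph_Theory"
    "Jordan_Normal_Form.Determinant"
    "HOL-Library.Poly_Mapping"
    "HOL-Computational_Algebra.Polynomial"
begin

type_synonym ('x, 'k) mpoly = "('x \<Rightarrow>\<^sub>0 nat) \<Rightarrow>\<^sub>0 'k"

definition mpoly_const :: "'k::zero \<Rightarrow> ('x, 'k) mpoly" where
  "mpoly_const c = Poly_Mapping.single 0 c"

definition mpoly_var :: "'x \<Rightarrow> ('x, 'k::zero_neq_one) mpoly" where
  "mpoly_var x = Poly_Mapping.single (Poly_Mapping.single x 1) 1"

datatype (dead 'k, label_vars: 'x) label = LConst 'k | LVar 'x

primrec label_mpoly :: "('k::zero_neq_one, 'x) label \<Rightarrow> ('x, 'k) mpoly" where
  "label_mpoly (LConst c) = mpoly_const c"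
| "label_mpoly (LVar x) = mpoly_var x"

text \<open>
  Parallel arcs are allowed, so that simple directed acyclic graphs are a special case.
  Nothing is assumed about the arcs entering the source or leaving the sink.
  The labelling is unconstrained, so the locale predicate does not mention it.
  A loop counts as a cycle in the sense of \<^const>\<open>pre_digraph.cycle\<close>.
\<close>

locale abp = fin_digraph G
  for G :: "('v, 'e) pre_digraph" +
  fixes source sink :: 'v
    and lab :: "'e \<Rightarrow> ('k::field, 'x) label"
  assumes source_in_verts: "source \<in> verts G"
    and sink_in_verts: "sink \<in> verts G"
    and acyclic: "\<nexists>c. cycle c"
begin

definition path_weight :: "'e awalk \<Rightarrow> ('x, 'k) mpoly" where
  "path_weight p = (\<Prod>e\<leftarrow>p. label_mpoly (lab e))"

definition computed_mpoly :: "('x, 'k) mpoly" where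
  "computed_mpoly = (\<Sum>p | apath source p sink. path_weight p)"

definition variables :: "'x set" where
  "variables = (\<Union>e\<in>arcs G. label_vars (lab e))"

definition size :: nat where
  "size = card (verts G) + card (arcs G)"

end

definition dpp :: "nat \<Rightarrow> 'k::field mat \<Rightarrow> (nat \<Rightarrow> ('k, 'x) label) \<Rightarrow> ('x, 'k) mpoly" where
  "dpp N L l = det (map_mat mpoly_const L + mat_diag N (\<lambda>i. label_mpoly (l i)))"

end

theory Submission
  imports Defs
begin

text \<open>
  Let \<open>F v\<close> be the weighted number of paths from the source to \<open>v\<close> and put \<open>w\<^sub>e = F (tail e)\<close> for
  each arc \<open>e\<close> with label \<open>x\<^sub>e\<close>. Splitting off the last arc of a path gives the linear system
  \<open>w\<^sub>e = q\<^sub>e + (\<Sum>e'. k\<^sub>e\<^sub>e\<^sub>' x\<^sub>e\<^sub>' w\<^sub>e\<^sub>')\<close>, where \<open>q\<close> and \<open>k\<close> are 0/1-valued and \<open>k\<close> is strictly triangular in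
  a topological order of the arcs; the computed polynomial is \<open>d + (\<Sum>e. p\<^sub>e x\<^sub>e w\<^sub>e)\<close> with 0/1-valued
  \<open>p\<close> and \<open>d\<close>. It is therefore the determinant of the bordered matrix \<open>S - K X\<close>, where \<open>S\<close> and
  \<open>K\<close> are constant and \<open>X\<close> is the diagonal matrix of labels. Finally,
  \<open>det (S - K X)\<close> equals the determinant of the block matrix with rows \<open>(X, -1)\<close> and \<open>(S, -K)\<close>,
  in which the labels occur only on the diagonal.
\<close>

section \<open>Determinants of block matrices\<close>

lemma det_four_block_unitriangular:
  fixes B :: "'a::comm_ring_1 mat"
  assumes "B \<in> carrier_mat n n"
  shows "det (four_block_mat (1\<^sub>m n) B (0\<^sub>m n n) (1\<^sub>m n)) = 1"
    and "det (four_block_mat (1\<^sub>m n) (0\<^sub>m n n) B (1\<^sub>m n)) = 1"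
proof -
  let ?U = "four_block_mat (1\<^sub>m n) B (0\<^sub>m n n) (1\<^sub>m n)"
  let ?L = "four_block_mat (1\<^sub>m n) (0\<^sub>m n n) B (1\<^sub>m n)"
  have "det ?U = prod_list (diag_mat ?U)"
    using assms by (intro det_upper_triangular[where n = "n + n"] upper_triangularI) auto
  also have "diag_mat ?U = map (\<lambda>_. 1) [0..<n + n]"
    using assms by (auto simp: diag_mat_def)
  finally show "det ?U = 1" by (simp add: map_replicate_const)
  have "det ?L = prod_list (diag_mat ?L)"
    using assms by (intro det_lower_triangular[where n = "n + n"]) auto
  also have "diag_mat ?L = map (\<lambda>_. 1) [0..<n + n]"
    using assms by (auto simp: diag_mat_def)
  finally show "det ?L = 1" by (simp add: map_replicate_const)
qed

text \<open>
  The factor \<open>W\<close> brings \<open>S - K X\<close> into lower triangular form; this way only determinants of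
  triangular matrices are needed, as the block determinant formulas of the library assume an
  integral domain.
\<close>

lemma det_four_block_linearization:
  fixes X S K W :: "'a::comm_ring_1 mat"
  assumes X: "X \<in> carrier_mat n n" and S: "S \<in> carrier_mat n n" and K: "K \<in> carrier_mat n n"
    and W: "W \<in> carrier_mat n n" "upper_triangular W" "\<And>i. i < n \<Longrightarrow> W $$ (i, i) = 1"
    and lower: "\<And>i j. i < j \<Longrightarrow> j < n \<Longrightarrow> ((S - K * X) * W) $$ (i, j) = 0"
  shows "det (four_block_mat X (- 1\<^sub>m n) S (- K)) = (\<Prod>i<n. ((S - K * X) * W) $$ (i, i))"
proof -
  let ?I = "1\<^sub>m n :: 'a mat" and ?O = "0\<^sub>m n n :: 'a mat"
  let ?M = "four_block_mat X (- ?I) S (- K)"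
  let ?D = "(S - K * X) * W"
  let ?U = "four_block_mat ?I ?I ?O ?I" and ?V = "four_block_mat ?I ?O (- ?I) ?I"
  let ?Y = "four_block_mat ?I (- X) ?O ?I" and ?W = "four_block_mat ?I ?O ?O W"
  let ?T = "four_block_mat ?I ?O K ?D"
  have KX: "K * X \<in> carrier_mat n n" using K X by (rule mult_carrier_mat)
  then have SKX: "S - K * X \<in> carrier_mat n n" by (rule minus_carrier_mat)
  then have D: "?D \<in> carrier_mat n n" using W(1) by (rule mult_carrier_mat)
  have M: "?M \<in> carrier_mat (n + n) (n + n)" using X S K by simp
  note carr [simp] = X S K W(1) KX SKX D
  note dims [simp] = carr[THEN carrier_matD(1)] carr[THEN carrier_matD(2)]
  text \<open>
    The product \<open>U V U\<close> realises the block rotation with rows \<open>(0, 1)\<close> and \<open>(-1, 0)\<close> by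
    unitriangular factors, so that its determinant is 1 in every characteristic.
  \<close>
  note mult = mult_four_block_mat[where ?nr1.0 = n and ?nr2.0 = n and ?n1.0 = n and ?n2.0 = n
    and ?nc1.0 = n and ?nc2.0 = n]
  have UV: "?U * ?V = four_block_mat ?O ?I (- ?I) ?I"
    by (subst mult) (auto simp: add_uminus_minus_mat minus_r_inv_mat)
  have J: "?U * ?V * ?U = four_block_mat ?O ?I (- ?I) ?O"
    unfolding UV by (subst mult) auto
  have JY: "?U * ?V * ?U * ?Y = four_block_mat ?O ?I (- ?I) X"
    unfolding J by (subst mult) auto
  \<comment> \<open>The rotation puts the identity in the upper left corner of \<open>?M\<close>;
    \<open>?Y\<close> uses it to clear the block \<open>X\<close> on its right, which leaves the
    Schur complement \<open>S - K * X\<close>.\<close>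
  have E: "?M * (?U * ?V * ?U * ?Y) = four_block_mat ?I ?O K (S - K * X)"
    unfolding JY by (subst mult) auto
  have T: "?M * (?U * ?V * ?U * ?Y) * ?W = ?T"
    unfolding E by (subst mult) auto
  have detW: "det ?W = 1"
  proof -
    have "det ?W = prod_list (diag_mat ?W)"
      using W by (intro det_upper_triangular[where n = "n + n"] upper_triangularI)
        (auto dest: upper_triangularD)
    also have "diag_mat ?W = map (\<lambda>_. 1) [0..<n + n]"
      using W by (auto simp: diag_mat_def)
    finally show ?thesis by (simp add: map_replicate_const)
  qed
  have detT: "det ?T = (\<Prod>i<n. ?D $$ (i, i))"
  proof -
    have "det ?T = prod_list (diag_mat ?T)"
      using lower D by (intro det_lower_triangular[where n = "n + n"]) auto
    also have "\<dots> = (\<Prod>i<n + n. ?T $$ (i, i))"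
      using D by (simp add: diag_mat_def prod.list_conv_set_nth atLeast0LessThan)
    also have "\<dots> = (\<Prod>i<n. ?T $$ (i, i)) * (\<Prod>i<n. ?T $$ (i + n, i + n))"
      unfolding lessThan_atLeast0
      by (simp add: prod.atLeastLessThan_concat[of 0 n "n + n", symmetric]
          prod.shift_bounds_nat_ivl[of _ 0 n n, simplified])
    also have "\<dots> = (\<Prod>i<n. ?D $$ (i, i))"
      using D by simp
    finally show ?thesis .
  qed
  have "det ?T = det ?M"
    unfolding T[symmetric]
    by (simp add: det_mult[where n = "n + n"] mult_carrier_mat[where n = "n + n"]
        four_block_carrier_mat M detW det_four_block_unitriangular)
  then show ?thesis using detT by simp
qed

text \<open>The labels fill the diagonal of the zero block of \<open>L\<close>. The padding label
  \<open>LConst 0\<close> leaves the diagonal of \<open>- K\<close> as it is.\<close>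

lemma dpp_linearization:
  fixes S K :: "nat \<Rightarrow> nat \<Rightarrow> 'k::field" and l :: "nat \<Rightarrow> ('k, 'x) label" and m :: nat
  defines "c \<equiv> mpoly_const :: 'k \<Rightarrow> ('x, 'k) mpoly"
  defines "L \<equiv> four_block_mat (0\<^sub>m m m) (- 1\<^sub>m m) (mat m m (case_prod S)) (- mat m m (case_prod K))"
  shows "dpp (m + m) L (\<lambda>i. if i < m then l i else LConst 0) =
    det (four_block_mat (mat_diag m (label_mpoly \<circ> l)) (- 1\<^sub>m m)
      (mat m m (\<lambda>(i, j). c (S i j))) (- mat m m (\<lambda>(i, j). c (K i j))))"
proof -
  have c: "c 0 = 0" "c 1 = 1" "\<And>a. c (- a) = - c a"
    by (simp_all add: c_def mpoly_const_def single_uminus)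
  show ?thesis
    unfolding dpp_def L_def
    by (intro arg_cong[where f = det] eq_matI) (auto simp: mat_diag_def c[unfolded c_def] c_def)
qed

section \<open>Path sums in an acyclic digraph\<close>

context abp
begin

definition path_sum :: "'v \<Rightarrow> ('x, 'k) mpoly" where
  "path_sum v = (\<Sum>p | apath source p v. path_weight p)"

text \<open>A repeated vertex would yield a closed walk and hence a cycle. Thus appending an arc to
  a path never requires a check that the vertices stay distinct.\<close>

lemma apath_iff_awalk: "apath u p v \<longleftrightarrow> awalk u p v"
proof
  assume walk: "awalk u p v"
  show "apath u p v"
  proof (rule ccontr)
    assume "\<not> apath u p v"
    then have "\<not> distinct (awalk_verts u p)" using walk by (simp add: apath_def)
    with walk obtain r where "closed_w r" by (blast elim: awalk_cyc_decompE')
    then show False using closed_w_imp_cycle acyclic by blast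
  qed
qed (simp add: apath_def)

lemma apath_snoc_iff: "apath u (p @ [e]) v \<longleftrightarrow> e \<in> in_arcs G v \<and> apath u p (tail G e)"
  unfolding apath_iff_awalk by (auto simp: awalk_Cons_iff awalk_Nil_iff)

text \<open>The \<open>of_bool\<close> term is the weight of the empty path; the nonempty paths fall
  into disjoint classes according to their last arc.\<close>

lemma path_sum_rec:
  assumes "v \<in> verts G"
  shows "path_sum v =
    of_bool (v = source) + (\<Sum>e\<in>in_arcs G v. label_mpoly (lab e) * path_sum (tail G e))"
proof -
  let ?P = "\<lambda>e. (\<lambda>p. p @ [e]) ` {p. apath source p (tail G e)}"
  have split: "{p. apath source p v} = (if v = source then {[]} else {}) \<union> (\<Union>e\<in>in_arcs G v. ?P e)"
    (is "_ = ?E \<union> ?U")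
  proof (rule Set.set_eqI)
    fix p show "p \<in> {p. apath source p v} \<longleftrightarrow> p \<in> ?E \<union> ?U"
      using assms by (cases p rule: rev_cases) (auto simp: apath_snoc_iff apath_Nil_iff)
  qed
  have fin: "finite (in_arcs G v)" "\<And>e. finite (?P e)"
    using apaths_finite by (auto simp: in_arcs_def)
  have "path_sum v = sum path_weight ?E + sum path_weight ?U"
    unfolding path_sum_def split using fin by (intro sum.union_disjoint) auto
  also have "sum path_weight ?E = of_bool (v = source)"
    by (simp add: path_weight_def)
  also have "sum path_weight ?U = (\<Sum>e\<in>in_arcs G v. sum path_weight (?P e))"
    using fin by (intro sum.UNION_disjoint) auto
  also have "\<dots> = (\<Sum>e\<in>in_arcs G v. label_mpoly (lab e) * path_sum (tail G e))"
    by (simp add: sum.reindex inj_on_def path_sum_def path_weight_def sum_distrib_left mult.commute)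
  finally show ?thesis .
qed

text \<open>The number of vertices that reach a vertex serves as its topological rank. The increase
  is strict because the head reaches itself but, by acyclicity, not the tail.\<close>

lemma card_reachable_less:
  assumes "e \<in> arcs G"
  shows "card {u. u \<rightarrow>\<^sup>*\<^bsub>G\<^esub> tail G e} < card {u. u \<rightarrow>\<^sup>*\<^bsub>G\<^esub> head G e}"
proof (rule psubset_card_mono)
  have "{u. u \<rightarrow>\<^sup>*\<^bsub>G\<^esub> head G e} \<subseteq> verts G" by (auto dest: reachable_in_verts)
  then show "finite {u. u \<rightarrow>\<^sup>*\<^bsub>G\<^esub> head G e}" by (rule finite_subset) simp
  have step: "tail G e \<rightarrow>\<^sup>*\<^bsub>G\<^esub> head G e"
    using assms by (blast intro: reachable_awalkI arc_implies_awalk)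
  have "\<not> head G e \<rightarrow>\<^sup>*\<^bsub>G\<^esub> tail G e"
  proof
    assume "head G e \<rightarrow>\<^sup>*\<^bsub>G\<^esub> tail G e"
    then obtain p where "awalk (head G e) p (tail G e)" by (auto simp: reachable_awalk)
    then have "closed_w (e # p)" using assms by (auto simp: closed_w_def awalk_Cons_iff)
    then show False using closed_w_imp_cycle acyclic by blast
  qed
  moreover have "head G e \<rightarrow>\<^sup>*\<^bsub>G\<^esub> head G e" using assms by simp
  ultimately show "{u. u \<rightarrow>\<^sup>*\<^bsub>G\<^esub> tail G e} \<subset> {u. u \<rightarrow>\<^sup>*\<^bsub>G\<^esub> head G e}"
    using step by (blast intro: reachable_trans)
qed

lemma topological_arc_order:
  obtains es where "set es = arcs G" "distinct es"
    "\<And>i j. i < length es \<Longrightarrow> j < length es \<Longrightarrow> head G (es ! j) = tail G (es ! i) \<Longrightarrow> j < i"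
proof -
  let ?r = "\<lambda>v. card {u. u \<rightarrow>\<^sup>*\<^bsub>G\<^esub> v}"
  obtain xs where xs: "set xs = arcs G" "distinct xs"
    using finite_distinct_list[OF finite_arcs] by blast
  \<comment> \<open>If one arc ends where another begins, its tail has strictly smaller rank, so
    sorting by the rank of the tail puts it first.\<close>
  define es where "es = sort_key (\<lambda>e. ?r (tail G e)) xs"
  show ?thesis
  proof
    show es: "set es = arcs G" "distinct es" using xs by (simp_all add: es_def)
    fix i j assume ij: "i < length es" "j < length es" "head G (es ! j) = tail G (es ! i)"
    have sorted: "sorted (map (\<lambda>e. ?r (tail G e)) es)" by (simp add: es_def)
    have "?r (tail G (es ! j)) < ?r (tail G (es ! i))"
      using card_reachable_less[of "es ! j"] ij es by (metis nth_mem)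
    then show "j < i"
      using sorted_nth_mono[OF sorted, of i j] ij by (auto simp: not_less[symmetric])
  qed
qed

end


section \<open>From a triangular linear system to a determinant\<close>

text \<open>Here \<open>S - K * X\<close> has the block rows \<open>(1 - k x, -q)\<close> and
  \<open>(p x, d)\<close>. Adding to the last column the combination of the others with coefficients
  \<open>w\<close> cancels \<open>-q\<close> and produces the desired value in the corner. The block
  \<open>1 - k x\<close> is lower unitriangular, so this corner is the whole determinant.\<close>

lemma det_bordered_linear_system:
  fixes k :: "nat \<Rightarrow> nat \<Rightarrow> 'a::comm_ring_1" and x q p w :: "nat \<Rightarrow> 'a" and d :: 'a
  assumes strict: "\<And>i j. i < n \<Longrightarrow> j < n \<Longrightarrow> i \<le> j \<Longrightarrow> k i j = 0"
    and sol: "\<And>i. i < n \<Longrightarrow> w i = q i + (\<Sum>j<n. k i j * x j * w j)"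
  defines "S \<equiv> \<lambda>i j. if i < n then if j < n then of_bool (i = j) else - q i else if j < n then 0 else d"
    and "K \<equiv> \<lambda>i j. if i < n \<and> j < n then k i j else if j < n then - p j else 0"
  shows "det (four_block_mat (mat_diag (Suc n) x) (- 1\<^sub>m (Suc n))
      (mat (Suc n) (Suc n) (case_prod S)) (- mat (Suc n) (Suc n) (case_prod K))) =
    d + (\<Sum>j<n. p j * x j * w j)"
proof -
  \<comment> \<open>This matrix performs the column operation: the identity with the solution
    \<open>w\<close> placed above the corner in its last column.\<close>
  define W where "W = mat (Suc n) (Suc n) (\<lambda>(i, j). if j < n \<or> i = n then of_bool (i = j) else w i)"
  let ?S = "mat (Suc n) (Suc n) (case_prod S)" and ?K = "mat (Suc n) (Suc n) (case_prod K)"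
  let ?X = "mat_diag (Suc n) x"
  let ?D = "(?S - ?K * ?X) * W"
  have D_sum: "?D $$ (i, j) = (\<Sum>m<Suc n. (S i m - K i m * x m) * W $$ (m, j))"
    if "i < Suc n" "j < Suc n" for i j
    using that by (simp add: mat_diag_mult_right[where nr = "Suc n"] W_def scalar_prod_def
        lessThan_atLeast0)
  have D_old: "?D $$ (i, j) = S i j - K i j * x j" if "i < Suc n" "j < n" for i j
  proof -
    have "?D $$ (i, j) = (\<Sum>m<Suc n. if m = j then S i m - K i m * x m else 0)"
      unfolding D_sum[OF that(1) less_SucI[OF that(2)]] using that
      by (intro sum.cong) (auto simp: W_def)
    then show ?thesis using that by simp
  qed
  have D_new: "?D $$ (i, n) = (\<Sum>m<n. (S i m - K i m * x m) * w m) + S i n"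
    if "i < Suc n" for i
    unfolding D_sum[OF that lessI] by (simp add: W_def K_def)
  have D_top: "?D $$ (i, n) = 0" if "i < n" for i
  proof -
    have "(\<Sum>m<n. (S i m - K i m * x m) * w m) =
        (\<Sum>m<n. (if m = i then w m else 0) - k i m * x m * w m)"
      using that by (intro sum.cong) (auto simp: S_def K_def algebra_simps)
    also have "\<dots> = w i - (\<Sum>m<n. k i m * x m * w m)"
      using that by (simp add: sum_subtractf)
    also have "\<dots> = q i" using sol[OF that] by simp
    finally show ?thesis using that D_new[of i] by (simp add: S_def)
  qed
  have D_corner: "?D $$ (n, n) = d + (\<Sum>j<n. p j * x j * w j)"
    using D_new[of n] by (simp add: S_def K_def)
  have "det (four_block_mat ?X (- 1\<^sub>m (Suc n)) ?S (- ?K)) = (\<Prod>i<Suc n. ?D $$ (i, i))"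
  proof (rule det_four_block_linearization)
    show "upper_triangular W" by (intro upper_triangularI) (auto simp: W_def)
    show "?D $$ (i, j) = 0" if "i < j" "j < Suc n" for i j
    proof (cases "j < n")
      case True
      with that show ?thesis using D_old[of i j] strict[of i j] by (simp add: S_def K_def)
    next
      case False
      with that have "j = n" by simp
      with that D_top[of i] show ?thesis by simp
    qed
  qed (auto simp: W_def)
  also have "\<dots> = (\<Prod>i<n. ?D $$ (i, i)) * (d + (\<Sum>j<n. p j * x j * w j))"
    by (simp only: prod.lessThan_Suc D_corner)
  also have "(\<Prod>i<n. ?D $$ (i, i)) = 1"
    using D_old strict by (intro prod.neutral) (simp add: S_def K_def)
  finally show ?thesis by simp
qed

text \<open>One index per arc and one for the border give blocks of order
  \<open>card (arcs G) + 1\<close>; the linearization doubles this.\<close>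

lemma (in abp) computed_mpoly_dpp:
  obtains L :: "'k mat" and l :: "nat \<Rightarrow> ('k, 'x) label"
  where "L \<in> carrier_mat (2 * card (arcs G) + 2) (2 * card (arcs G) + 2)"
    and "\<And>i. label_vars (l i) \<subseteq> variables"
    and "computed_mpoly = dpp (2 * card (arcs G) + 2) L l"
proof -
  obtain es where es: "set es = arcs G" "distinct es"
    and order: "\<And>i j. i < length es \<Longrightarrow> j < length es \<Longrightarrow>
      head G (es ! j) = tail G (es ! i) \<Longrightarrow> j < i"
    using topological_arc_order by blast
  define n where "n = length es"
  have n: "card (arcs G) = n" using es distinct_card n_def by metis
  let ?c = "mpoly_const :: 'k \<Rightarrow> ('x, 'k) mpoly"
  define k :: "nat \<Rightarrow> nat \<Rightarrow> 'k" where "k i j = of_bool (head G (es ! j) = tail G (es ! i))" for i j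
  define q :: "nat \<Rightarrow> 'k" where "q i = of_bool (tail G (es ! i) = source)" for i
  define p :: "nat \<Rightarrow> 'k" where "p j = of_bool (head G (es ! j) = sink)" for j
  \<comment> \<open>This accounts for the empty path, which contributes when source and sink
    coincide.\<close>
  define d :: 'k where "d = of_bool (source = sink)"
  \<comment> \<open>A constant at the border index \<open>n\<close> and beyond introduces no
    variable.\<close>
  define l where "l i = (if i < n then lab (es ! i) else LConst 0)" for i
  define w where "w i = path_sum (tail G (es ! i))" for i
  define S where "S i j =
    (if i < n then if j < n then of_bool (i = j) else - q i else if j < n then 0 else d)" for i j
  define K where "K i j = (if i < n \<and> j < n then k i j else if j < n then - p j else 0)" for i j
  define L where "L = four_block_mat (0\<^sub>m (Suc n) (Suc n)) (- 1\<^sub>m (Suc n))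
    (mat (Suc n) (Suc n) (case_prod S)) (- mat (Suc n) (Suc n) (case_prod K))"
  have c: "?c 0 = 0" "?c 1 = 1" "?c (- a) = - ?c a" "?c (of_bool b) = of_bool b" for a b
    by (cases b; simp add: mpoly_const_def single_uminus)+
  have bij: "bij_betw ((!) es) {..<n} (arcs G)"
    using es by (simp add: n_def bij_betw_nth)
  \<comment> \<open>The recursion over arc positions is used twice: at the tails of arcs it is the
    linear system for \<open>w\<close>, and at the sink it identifies the corner entry with the
    computed polynomial.\<close>
  have rec: "path_sum v = of_bool (v = source) +
      (\<Sum>j<n. of_bool (head G (es ! j) = v) * label_mpoly (l j) * w j)" if "v \<in> verts G" for v
  proof -
    have "(\<Sum>e\<in>in_arcs G v. label_mpoly (lab e) * path_sum (tail G e)) =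
        (\<Sum>e\<in>arcs G. of_bool (head G e = v) * label_mpoly (lab e) * path_sum (tail G e))"
      by (intro sum.mono_neutral_cong_left) (auto simp: in_arcs_def)
    also have "\<dots> = (\<Sum>j<n. of_bool (head G (es ! j) = v) * label_mpoly (l j) * w j)"
      unfolding sum.reindex_bij_betw[OF bij, symmetric]
      by (intro sum.cong) (auto simp: l_def w_def)
    finally show ?thesis using path_sum_rec[OF that] by simp
  qed
  have "dpp (Suc n + Suc n) L (\<lambda>i. if i < Suc n then l i else LConst 0) =
      det (four_block_mat (mat_diag (Suc n) (label_mpoly \<circ> l)) (- 1\<^sub>m (Suc n))
        (mat (Suc n) (Suc n) (\<lambda>(i, j). ?c (S i j))) (- mat (Suc n) (Suc n) (\<lambda>(i, j). ?c (K i j))))"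
    unfolding L_def by (rule dpp_linearization)
  also have "(\<lambda>(i, j). ?c (S i j)) = (\<lambda>(i, j). if i < n
      then if j < n then of_bool (i = j) else - ?c (q i) else if j < n then 0 else ?c d)"
    by (auto simp: S_def c fun_eq_iff)
  also have "(\<lambda>(i, j). ?c (K i j)) =
      (\<lambda>(i, j). if i < n \<and> j < n then ?c (k i j) else if j < n then - ?c (p j) else 0)"
    by (auto simp: K_def c fun_eq_iff)
  also have "det (four_block_mat (mat_diag (Suc n) (label_mpoly \<circ> l)) (- 1\<^sub>m (Suc n))
      (mat (Suc n) (Suc n) (\<lambda>(i, j). if i < n
        then if j < n then of_bool (i = j) else - ?c (q i) else if j < n then 0 else ?c d))
      (- mat (Suc n) (Suc n)
        (\<lambda>(i, j). if i < n \<and> j < n then ?c (k i j) else if j < n then - ?c (p j) else 0))) =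
      ?c d + (\<Sum>j<n. ?c (p j) * (label_mpoly \<circ> l) j * w j)"
  proof (rule det_bordered_linear_system)
    show "?c (k i j) = 0" if "i < n" "j < n" "i \<le> j" for i j
      using order[of i j] that by (auto simp: k_def c n_def)
    show "w i = ?c (q i) + (\<Sum>j<n. ?c (k i j) * (label_mpoly \<circ> l) j * w j)" if "i < n" for i
    proof -
      have "es ! i \<in> arcs G" using that es nth_mem unfolding n_def by blast
      then have "w i = of_bool (tail G (es ! i) = source) +
          (\<Sum>j<n. of_bool (head G (es ! j) = tail G (es ! i)) * label_mpoly (l j) * w j)"
        unfolding w_def[of i] by (intro rec) simp
      then show ?thesis by (simp only: k_def q_def c o_apply)
    qed
  qed
  also have "\<dots> = path_sum sink"
    using rec[OF sink_in_verts] by (simp add: p_def d_def c eq_commute)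
  finally have "computed_mpoly = dpp (Suc n + Suc n) L (\<lambda>i. if i < Suc n then l i else LConst 0)"
    by (simp add: computed_mpoly_def path_sum_def)
  moreover have "L \<in> carrier_mat (Suc n + Suc n) (Suc n + Suc n)"
    unfolding L_def by (rule four_block_carrier_mat) simp_all
  moreover have "label_vars (if i < Suc n then l i else LConst 0) \<subseteq> variables" for i
    using es nth_mem[of i es] by (auto simp: l_def variables_def n_def)
  ultimately show ?thesis
    using that[of L "\<lambda>i. if i < Suc n then l i else LConst 0"] by (simp add: n mult_2)
qed

theorem theorem7:
  shows "\<exists>q :: nat poly.
    \<forall>(G :: ('v, 'e) pre_digraph) source sink (lab :: 'e \<Rightarrow> ('k::field, 'x) label).
      abp G source sink \<longrightarrow>
      (\<exists>N (L :: 'k mat) (l :: nat \<Rightarrow> ('k, 'x) label).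
        N \<le> poly q (abp.size G) \<and>
        L \<in> carrier_mat N N \<and>
        (\<forall>i<N. label_vars (l i) \<subseteq> abp.variables G lab) \<and>
        abp.computed_mpoly G source sink lab = dpp N L l)"
\<comment> \<open>The linear bound \<open>2 * size + 2\<close> suffices, as the size counts every
  arc.\<close>
proof (intro exI[of _ "[:2, 2:]"] allI impI)
  fix G :: "('v, 'e) pre_digraph" and source sink :: 'v and lab :: "'e \<Rightarrow> ('k, 'x) label"
  assume "abp G source sink"
  then interpret abp G source sink lab .
  let ?N = "2 * card (arcs G) + 2"
  obtain L l where "L \<in> carrier_mat ?N ?N" "\<And>i. label_vars (l i) \<subseteq> variables"
    "computed_mpoly = dpp ?N L l"
    using computed_mpoly_dpp by blast
  moreover have "?N \<le> poly [:2, 2:] size"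
    by (simp add: size_def)
  ultimately show "\<exists>N L l. N \<le> poly [:2, 2:] size \<and> L \<in> carrier_mat N N \<and>
      (\<forall>i<N. label_vars (l i) \<subseteq> variables) \<and> computed_mpoly = dpp N L l"
    by blast
qed

end
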